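(* If $\boldsymbol{T}$ is a symmetric and futile $n$-player tournament, then $\pi_1(P) = \dots = \pi_n(P) = \frac{1}{n}$ for every $P\in\mathcal{M}_n$ (i.e. in any specialization of $\boldsymbol{T}$).
   Context: Write $[n]=\{1,\dots,n\}$ for the set of players. Let $\mathcal{M}_n=\{P=(p_{ij})\in[0,1]^{n\times n}: P+P^T=\mathbf{1}\}$, where $\mathbf{1}$ is the all-ones matrix (so $p_{ij}+p_{ji}=1$ and $p_{ii}=\frac12$). An $n$-player tournament $\boldsymbol{T}$ is a set of rules (a randomized algorithm) which, one match at a time, announces an unordered pair $\{i,j\}$ of distinct players who then play a match, receives as only information which of the two won (no draws), and eventually announces one of the $n$ players as tournament winner. The choice of the next pair, and of the winner, may depend on the results of earlier matches and on additional randomness. The number of matches is bounded by a constant depending only on $\boldsymbol{T}$. For $P\in\mathcal{M}_n$, the specialization $(\boldsymbol{T},P)$ is the random process in which every match between $i$ and $j$ is won by $i$ with probability $p_{ij}$, independently of the past; $\pi_i(P)$ is the probability that player $i$ wins the tournament. Symmetric: for every $P\in\mathcal{M}_n$, every permutation $\sigma$ of $[n]$ and every $i\in[n]$, $\pi_i(P)=\pi_{\sigma(i)}(Q)$, where $Q\in\mathcal{M}_n$ is defined by $q_{\sigma(i)\sigma(j)}=p_{ij}$. Futile: for every possible state of $\boldsymbol{T}$ in which $r\ge0$ matches have been played and a pair $\{i,j\}$ has just been announced for match $r+1$ (the state includes the results of the previous matches and all random choices already made by the rules), and every $P\in\mathcal{M}_n$, one has $\pi_i^+(P)=\pi_i^-(P)$,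 where $\pi_i^+(P)$ (resp. $\pi_i^-(P)$) is the probability that $i$ wins the tournament conditioned on the current state and on $i$ winning (resp. losing) match $r+1$, with all subsequent matches decided according to $P$. *)

theory Defs
  imports "HOL-Probability.Probability"
begin

text \<open>
  The set of players is a finite type \<open>'n\<close>, so that \<open>n = CARD('n)\<close>; tournament matrices
  are elements of \<open>real ^ 'n ^ 'n\<close>.
\<close>

definition tournament_matrices :: "(real ^ 'n ^ 'n) set" where
  "tournament_matrices =
     {P. (\<forall>i j. P $ i $ j \<in> {0..1}) \<and> P + transpose P = (\<chi> i j. 1)}"

text \<open>
  A set of rules is represented by the tree of its possible executions: a node is a state, and
  the subtree below it describes the rest of the tournament from that state on.
  \<^item> \<open>Champion i\<close> announces \<open>i\<close> as the tournament winner.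
  \<^item> \<open>Match i j t u\<close> announces the pair \<open>{i, j}\<close> and continues with \<open>t\<close> if \<open>i\<close> wins the match
    and with \<open>u\<close> if \<open>j\<close> wins it; \<open>Match i j t u\<close> and \<open>Match j i u t\<close> stand for the same rules.
  \<^item> \<open>Chance M f\<close> draws \<open>x\<close> from the probability space \<open>M\<close> and continues with \<open>f x\<close>.
    The space \<open>M\<close> may depend on the whole history, and the outcome \<open>x\<close> may be used at any later
    point, not only for the next announcement. The randomness need not be discrete.
\<close>

datatype ('n, 'r) rules =
    Champion 'n
  | Match 'n 'n "('n, 'r) rules" "('n, 'r) rules"
  | Chance "'r measure" "'r \<Rightarrow> ('n, 'r) rules"

text \<open>The law of the tournament winner in the specialization to the matrix \<open>P\<close>.\<close>

primrec champion :: "('n::finite, 'r) rules \<Rightarrow> real ^ 'n ^ 'n \<Rightarrow> 'n measure" where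
  "champion (Champion i) P = return (count_space UNIV) i"
| "champion (Match i j t u) P =
     measure_pmf (bernoulli_pmf (P $ i $ j)) \<bind>
       (\<lambda>i_wins. if i_wins then champion t P else champion u P)"
| "champion (Chance M f) P = M \<bind> (\<lambda>x. champion (f x) P)"

definition win_prob :: "('n::finite, 'r) rules \<Rightarrow> real ^ 'n ^ 'n \<Rightarrow> 'n \<Rightarrow> real" where
  "win_prob t P i = measure (champion t P) {i}"

primrec max_matches :: "('n, 'r) rules \<Rightarrow> enat" where
  "max_matches (Champion i) = 0"
| "max_matches (Match i j t u) = 1 + max (max_matches t) (max_matches u)"
| "max_matches (Chance M f) = (SUP x\<in>space M. max_matches (f x))"

text \<open>
  The measurability condition makes the monadic bind in \<^const>\<open>champion\<close> meaningful; it holds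
  automatically if all subsets of \<open>space M\<close> are measurable.
\<close>

primrec well_formed :: "('n::finite, 'r) rules \<Rightarrow> bool" where
  "well_formed (Champion i) \<longleftrightarrow> True"
| "well_formed (Match i j t u) \<longleftrightarrow> i \<noteq> j \<and> well_formed t \<and> well_formed u"
| "well_formed (Chance M f) \<longleftrightarrow>
     prob_space M \<and> (\<forall>x\<in>space M. well_formed (f x)) \<and>
     (\<forall>P\<in>tournament_matrices.
        (\<lambda>x. champion (f x) P) \<in> M \<rightarrow>\<^sub>M subprob_algebra (count_space UNIV))"

definition tournament :: "('n::finite, 'r) rules \<Rightarrow> bool" where
  "tournament t \<longleftrightarrow> well_formed t \<and> max_matches t \<noteq> \<infinity>"

definition symmetric_tournament :: "('n::finite, 'r) rules \<Rightarrow> bool" where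
  "symmetric_tournament t \<longleftrightarrow>
     (\<forall>P\<in>tournament_matrices. \<forall>Q\<in>tournament_matrices. \<forall>\<sigma>. \<sigma> permutes UNIV \<longrightarrow>
        (\<forall>i j. Q $ \<sigma> i $ \<sigma> j = P $ i $ j) \<longrightarrow>
        (\<forall>i. win_prob t P i = win_prob t Q (\<sigma> i)))"

text \<open>
  At a node \<open>Match i j t u\<close>, the winning probability of \<open>i\<close> conditioned on the state and on \<open>i\<close>
  winning (losing) the match is its winning probability in \<open>t\<close> (in \<open>u\<close>); for \<open>j\<close> the roles
  of \<open>t\<close> and \<open>u\<close> are exchanged. Outcomes of random choices are possible up to null sets, which for
  discrete randomness means exactly the outcomes of positive probability.
\<close>

primrec futile_tournament :: "('n::finite, 'r) rules \<Rightarrow> bool" where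
  "futile_tournament (Champion i) \<longleftrightarrow> True"
| "futile_tournament (Match i j t u) \<longleftrightarrow>
     (\<forall>P\<in>tournament_matrices.
        win_prob t P i = win_prob u P i \<and> win_prob u P j = win_prob t P j) \<and>
     futile_tournament t \<and> futile_tournament u"
| "futile_tournament (Chance M f) \<longleftrightarrow> (AE x in M. futile_tournament (f x))"

end

theory Submission imports Defs begin

text \<open>
  Futility makes \<open>\<pi>\<^sub>i(P)\<close> independent of the row and column of \<open>i\<close> in \<open>P\<close>. Fix a player \<open>v\<close> and
  call \<open>j\<close> a clone of \<open>v\<close> if the rows of \<open>j\<close> and \<open>v\<close> in \<open>P\<close> agree. A player \<open>j\<close> that is not
  a clone can be turned into one without changing \<open>\<pi>\<^sub>j\<close>, so by induction on the number
  of non-clones \<open>\<pi>\<^sub>j(P) = 1/n\<close>. The clones have equal winning probabilities by symmetry, and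
  since all probabilities sum to \<open>1\<close>, these are \<open>1/n\<close> as well.
\<close>

lemma tournament_matrices_iff:
  "P \<in> tournament_matrices \<longleftrightarrow>
     (\<forall>i j. P $ i $ j \<in> {0..1}) \<and> (\<forall>i j. P $ i $ j + P $ j $ i = 1)"
  by (simp add: tournament_matrices_def vec_eq_iff Finite_Cartesian_Product.transpose_def)

lemma emeasure_champion_Match:
  assumes "P \<in> tournament_matrices"
    and "champion t P \<in> space (subprob_algebra (count_space UNIV))"
    and "champion u P \<in> space (subprob_algebra (count_space UNIV))"
  shows "emeasure (champion (Match i j t u) P) A =
    ennreal (P $ i $ j) * emeasure (champion t P) A +
    ennreal (1 - P $ i $ j) * emeasure (champion u P) A"
proof -
  have "P $ i $ j \<in> {0..1}"
    using assms(1) by (simp add: tournament_matrices_iff)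
  moreover have "(\<lambda>b. if b then champion t P else champion u P)
      \<in> measure_pmf (bernoulli_pmf (P $ i $ j)) \<rightarrow>\<^sub>M subprob_algebra (count_space UNIV)"
    using assms(2,3) by (auto simp: measurable_def)
  ultimately show ?thesis
    by (simp add: emeasure_bind[where N = "count_space UNIV"] mult.commute)
qed

text \<open>Measurability in \<open>well_formed\<close> only speaks of subprobability kernels; total
  mass 1 of each \<open>K x\<close> is therefore a separate pointwise hypothesis and passes to the
  bind.\<close>

lemma bind_in_prob_algebra:
  assumes "prob_space M" "K \<in> M \<rightarrow>\<^sub>M subprob_algebra N"
    and "\<And>x. x \<in> space M \<Longrightarrow> prob_space (K x)"
  shows "M \<bind> K \<in> space (prob_algebra N)"
proof -
  interpret prob_space M by fact
  have "prob_space (M \<bind> K)"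
    by (rule prob_space_bind[OF _ assms(2)]) (use assms(3) in auto)
  moreover have "sets (M \<bind> K) = sets N"
    using sets_kernel[OF assms(2)] not_empty by (rule sets_bind)
  ultimately show ?thesis by (simp add: space_prob_algebra)
qed

text \<open>No mass is lost anywhere in the tree, which is what later makes the winning
  probabilities sum to 1.\<close>

lemma champion_in_prob_algebra:
  assumes "well_formed t" "P \<in> tournament_matrices"
  shows "champion t P \<in> space (prob_algebra (count_space UNIV))"
  using assms(1)
proof (induction t)
  case (Champion i)
  then show ?case
    by (auto simp: space_prob_algebra prob_space_return)
next
  case (Match i j t u)
  then have "prob_space (champion t P)" "sets (champion t P) = UNIV"
    "prob_space (champion u P)" "sets (champion u P) = UNIV"
    by (auto simp: space_prob_algebra)
  then have "measure_pmf (bernoulli_pmf (P $ i $ j)) \<bind>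
      (\<lambda>b. if b then champion t P else champion u P) \<in> space (prob_algebra (count_space UNIV))"
    by (intro bind_in_prob_algebra)
      (auto simp: measurable_def space_subprob_algebra prob_space_imp_subprob_space
        prob_space_measure_pmf)
  then show ?case by simp
next
  case (Chance M f)
  then have "prob_space (champion (f x) P)" if "x \<in> space M" for x
    using that by (auto simp: space_prob_algebra)
  then show ?case
    using Chance.prems assms(2) by (auto intro!: bind_in_prob_algebra)
qed

lemma champion_in_subprob_algebra:
  assumes "well_formed t" "P \<in> tournament_matrices"
  shows "champion t P \<in> space (subprob_algebra (count_space UNIV))"
  using champion_in_prob_algebra[OF assms]
  by (auto simp: space_prob_algebra space_subprob_algebra prob_space_imp_subprob_space)

lemma win_prob_Match:
  assumes "well_formed (Match i j t u)" "P \<in> tournament_matrices"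
  shows "win_prob (Match i j t u) P k =
    P $ i $ j * win_prob t P k + (1 - P $ i $ j) * win_prob u P k"
proof -
  have p: "0 \<le> P $ i $ j" "P $ i $ j \<le> 1"
    using assms(2) by (auto simp: tournament_matrices_iff)
  have "finite_measure (champion t P)" "finite_measure (champion u P)"
    using assms champion_in_prob_algebra
    by (auto simp: space_prob_algebra intro!: prob_space.finite_measure)
  moreover have "emeasure (champion (Match i j t u) P) {k} =
      ennreal (P $ i $ j) * emeasure (champion t P) {k} +
      ennreal (1 - P $ i $ j) * emeasure (champion u P) {k}"
    using assms by (intro emeasure_champion_Match champion_in_subprob_algebra) auto
  ultimately have "emeasure (champion (Match i j t u) P) {k} =
      ennreal (P $ i $ j * win_prob t P k + (1 - P $ i $ j) * win_prob u P k)"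
    using p by (simp add: win_prob_def finite_measure.emeasure_eq_measure ennreal_mult
        del: champion.simps)
  then show ?thesis
    using p unfolding win_prob_def[of "Match i j t u"]
    by (intro measure_eq_emeasure_eq_ennreal) (simp_all add: win_prob_def)
qed

lemma sum_win_prob:
  assumes "well_formed t" "P \<in> tournament_matrices"
  shows "(\<Sum>i\<in>UNIV. win_prob t P i) = 1"
proof -
  have sets: "sets (champion t P) = UNIV" and "prob_space (champion t P)"
    using champion_in_prob_algebra[OF assms] by (auto simp: space_prob_algebra)
  then interpret prob_space "champion t P" by simp
  have "space (champion t P) = UNIV"
    using sets sets.sets_into_space by blast
  then show ?thesis
    using finite_measure_eq_sum_singleton[of UNIV] prob_space
    by (simp add: win_prob_def sets)
qed

text \<open>Induction on the tree: an entry of the matrix matters only at a match between its two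
  players. If \<open>i\<close> takes part, futility gives both continuations the same value for
  \<open>i\<close>, so the entry cancels; otherwise \<open>P\<close> and \<open>Q\<close> have the
  same entry there.\<close>

lemma win_prob_cong_own_row:
  assumes "well_formed t" "futile_tournament t"
    and P: "P \<in> tournament_matrices" and Q: "Q \<in> tournament_matrices"
    and eq: "\<And>k l. k \<noteq> i \<Longrightarrow> l \<noteq> i \<Longrightarrow> P $ k $ l = Q $ k $ l"
  shows "win_prob t P i = win_prob t Q i"
  using assms(1,2)
proof (induction t)
  case (Champion j)
  then show ?case by (simp add: win_prob_def)
next
  case (Match j k t u)
  have IH: "win_prob t P i = win_prob t Q i" "win_prob u P i = win_prob u Q i"
    using Match by auto
  show ?case
  proof (cases "i = j \<or> i = k")
    case True
    then have "win_prob t R i = win_prob u R i" if "R \<in> tournament_matrices" for R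
      using Match.prems(2) that by auto
    then show ?thesis
      using P Q IH by (simp add: win_prob_Match[OF Match.prems(1)] algebra_simps)
  next
    case False
    then have "P $ j $ k = Q $ j $ k" by (intro eq) auto
    then show ?thesis
      using P Q IH by (simp add: win_prob_Match[OF Match.prems(1)])
  qed
next
  case (Chance M f)
  interpret prob_space M using Chance.prems by simp
  have emeasure: "emeasure (champion (f x) R) {i} = ennreal (win_prob (f x) R i)"
    if "x \<in> space M" "R \<in> tournament_matrices" for x R
  proof -
    have "prob_space (champion (f x) R)"
      using champion_in_prob_algebra[of "f x" R] Chance.prems(1) that
      by (simp add: space_prob_algebra)
    then show ?thesis
      by (simp add: win_prob_def finite_measure.emeasure_eq_measure prob_space.finite_measure)
  qed
  have "AE x in M. futile_tournament (f x)"
    using Chance.prems(2) by simp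
  \<comment> \<open>Futility is known only almost everywhere, so the induction hypothesis is applied
    pointwise off a null set, which the integral over \<open>M\<close> ignores.\<close>
  then have "AE x in M. emeasure (champion (f x) P) {i} = emeasure (champion (f x) Q) {i}"
  proof (rule AE_mp, intro AE_I2 impI)
    fix x assume x: "x \<in> space M" and "futile_tournament (f x)"
    then have "win_prob (f x) P i = win_prob (f x) Q i"
      using Chance.IH[OF rangeI] Chance.prems(1) by simp
    then show "emeasure (champion (f x) P) {i} = emeasure (champion (f x) Q) {i}"
      by (simp add: emeasure x P Q)
  qed
  then have "(\<integral>\<^sup>+x. emeasure (champion (f x) P) {i} \<partial>M) =
      (\<integral>\<^sup>+x. emeasure (champion (f x) Q) {i} \<partial>M)"
    by (rule nn_integral_cong_AE)
  moreover have "emeasure (champion (Chance M f) R) {i} =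
      (\<integral>\<^sup>+x. emeasure (champion (f x) R) {i} \<partial>M)" if "R \<in> tournament_matrices" for R
    using Chance.prems that not_empty
    by (simp add: emeasure_bind[where N = "count_space UNIV"])
  ultimately show ?case
    unfolding win_prob_def measure_def by (simp add: P Q del: champion.simps)
qed

text \<open>Since \<open>P $ k $ l = 1 - P $ l $ k\<close>, equal rows force equal columns. The
  transposition of \<open>i\<close> and \<open>j\<close> thus leaves \<open>P\<close> unchanged, and
  symmetry applies with both matrices equal to \<open>P\<close>.\<close>

lemma win_prob_eq_of_row_eq:
  assumes "symmetric_tournament t" "P \<in> tournament_matrices" and row: "P $ i = P $ j"
  shows "win_prob t P i = win_prob t P j"
proof -
  have flip: "P $ k $ l = 1 - P $ l $ k" for k l
    using assms(2) by (simp add: tournament_matrices_iff eq_diff_eq)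
  have col: "P $ k $ i = P $ k $ j" for k
    using flip[of k i] flip[of k j] row by simp
  let ?\<sigma> = "Transposition.transpose i j"
  have "P $ ?\<sigma> k = P $ k" for k
    using row by (metis transpose_apply_first transpose_apply_second transpose_apply_other)
  moreover have "P $ k $ ?\<sigma> l = P $ k $ l" for k l
    using col by (metis transpose_apply_first transpose_apply_second transpose_apply_other)
  ultimately have "\<forall>k l. P $ ?\<sigma> k $ ?\<sigma> l = P $ k $ l"
    by simp
  moreover have "?\<sigma> permutes UNIV"
    by (rule permutes_swap_id) auto
  ultimately have "\<forall>k. win_prob t P k = win_prob t P (?\<sigma> k)"
    using assms(1)[unfolded symmetric_tournament_def, rule_format, of P P ?\<sigma>] assms(2) by simp
  then have "win_prob t P i = win_prob t P (?\<sigma> i)" ..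
  then show ?thesis by simp
qed

lemma win_prob_uniform:
  fixes T :: "('n::finite, 'r) rules"
  assumes wf: "well_formed T" and sym: "symmetric_tournament T" and fut: "futile_tournament T"
    and "P \<in> tournament_matrices"
  shows "win_prob T P i = 1 / real CARD('n)"
proof -
  fix v :: 'n
  show ?thesis
    using assms(4)
  proof (induction "card {j. P $ j \<noteq> P $ v}" arbitrary: P i rule: less_induct)
    case less
    have non_clone: "win_prob T P j = 1 / real CARD('n)" if j: "P $ j \<noteq> P $ v" for j
    proof -
      \<comment> \<open>In \<open>Q\<close>, player \<open>j\<close> plays exactly as
        \<open>v\<close> does: only row and column \<open>j\<close> of \<open>P\<close> change, and
        \<open>j\<close> against \<open>v\<close> gets the entry \<open>P $ v $ v\<close>, that is
        1/2.\<close>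
      define s where "s = (\<lambda>k. if k = j then v else k)"
      define Q :: "real ^ 'n ^ 'n" where "Q = (\<chi> k l. P $ s k $ s l)"
      have Q: "Q \<in> tournament_matrices"
        using less.prems by (simp add: tournament_matrices_iff Q_def)
      \<comment> \<open>Player \<open>j\<close> becomes a clone because \<open>s j = s v\<close>.
        Old clones differ from \<open>j\<close>, so \<open>s\<close> fixes them, and they stay
        clones: their rows and that of \<open>v\<close> are reindexed by the same
        \<open>s\<close>.\<close>
      have "{k. Q $ k \<noteq> Q $ v} \<subseteq> {k. P $ k \<noteq> P $ v} - {j}"
        by (auto simp: Q_def s_def vec_eq_iff)
      with j have "{k. Q $ k \<noteq> Q $ v} \<subset> {k. P $ k \<noteq> P $ v}" by blast
      then have "card {k. Q $ k \<noteq> Q $ v} < card {k. P $ k \<noteq> P $ v}"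
        by (simp add: psubset_card_mono)
      then have "win_prob T Q j = 1 / real CARD('n)"
        using Q by (rule less.hyps)
      moreover have "win_prob T P j = win_prob T Q j"
        using wf fut less.prems Q by (rule win_prob_cong_own_row) (simp add: Q_def s_def)
      ultimately show ?thesis by simp
    qed
    let ?C = "{j. P $ j = P $ v}"
    have clone: "win_prob T P j = win_prob T P v" if "P $ j = P $ v" for j
      using sym less.prems that by (rule win_prob_eq_of_row_eq)
    \<comment> \<open>Deviations from 1/n sum to 0 and vanish at non-clones. What remains is the
      number of clones times the deviation at \<open>v\<close>; that number is positive, as
      \<open>v\<close> is its own clone.\<close>
    have "0 = (\<Sum>j\<in>UNIV. win_prob T P j - 1 / real CARD('n))"
      using sum_win_prob[OF wf less.prems] by (simp add: sum_subtractf)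
    also have "\<dots> = (\<Sum>j\<in>?C. win_prob T P j - 1 / real CARD('n))"
      by (rule sum.mono_neutral_right) (auto simp: non_clone)
    also have "\<dots> = (\<Sum>j\<in>?C. win_prob T P v - 1 / real CARD('n))"
    proof (rule sum.cong)
      fix j assume "j \<in> ?C"
      then have "win_prob T P j = win_prob T P v"
        using clone by blast
      then show "win_prob T P j - 1 / real CARD('n) = win_prob T P v - 1 / real CARD('n)"
        by (rule arg_cong)
    qed (rule refl)
    finally have "card ?C = 0 \<or> win_prob T P v = 1 / real CARD('n)"
      by simp
    moreover have "v \<in> ?C" by simp
    ultimately have "win_prob T P v = 1 / real CARD('n)"
      by (metis card_0_eq empty_iff finite)
    then show ?case
      using clone[of i] non_clone[of i] by metis
  qed
qed

theorem proposition7p2: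
  fixes T :: "('n::finite, 'r) rules"
  assumes "tournament T"
    and "symmetric_tournament T"
    and "futile_tournament T"
  shows "\<forall>P\<in>tournament_matrices. \<forall>i. win_prob T P i = 1 / real CARD('n)"
  using assms win_prob_uniform unfolding tournament_def by blast

end
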